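(* Let $F:\mathbb{R}^n\times\mathbb{R}^m\to\mathbb{R}$ be continuously differentiable, with $\operatorname{Saddle}(F)\neq\emptyset$. Suppose that (i) $F$ is locally convex-concave on $\operatorname{Saddle}(F)$ and linear in $z$; (ii) for each $(x_*,z_* )\in\operatorname{Saddle}(F)$, there exists a neighborhood $\mathcal U_{x_*}\subset\mathbb{R}^n$ of $x_*$ such that, if $F(x,z_* )=F(x_*,z_* )$ with $x\in\mathcal U_{x_*}$, then $(x,z_* )\in\operatorname{Saddle}(F)$. Then each isolated path connected component of $\operatorname{Saddle}(F)$ is locally asymptotically stable under the saddle-point dynamics $X_{\text{sp}}$ of $F$ and, moreover, the convergence of trajectories is to a point.
   Context: Saddle-point dynamics: for a continuously differentiable $F:\mathbb{R}^n\times\mathbb{R}^m\to\mathbb{R}$ it is $\dot x=-\nabla_xF(x,z)$, $\dot z=\nabla_zF(x,z)$, with vector field denoted $X_{\text{sp}}$. Trajectories are solutions on $t\ge 0$. Saddle points: $(x_*,z_* )$ is a (local min-max) saddle point of $F$ if there are open neighborhoods $\mathcal U_{x_*}\subset\mathbb{R}^n$ of $x_*$ and $\mathcal U_{z_*}\subset\mathbb{R}^m$ of $z_*$ with $F(x_*,z)\le F(x_*,z_* )\le F(x,z_* )$ for all $z\in\mathcal U_{z_*}$, $x\in\mathcal U_{x_*}$. $\operatorname{Saddle}(F)$ is the set of all such points; it is assumed nonempty. Local convexity-concavity: $F$ is locally convex-concave at $(\tilde x,\tilde z)$ if there is an open neighborhood $\mathcal U$ of $(\tilde x,\tilde z)$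 such that for all $(\bar x,\bar z)\in\mathcal U$ the function $x\mapsto F(x,\bar z)$ is convex over $\mathcal U\cap(\mathbb{R}^n\times\{\bar z\})$ and $z\mapsto F(\bar x,z)$ is concave over $\mathcal U\cap(\{\bar x\}\times\mathbb{R}^m)$. It is so on a set if it is so at each point of the set. "Linear in $z$" means that for each $x$ the map $z\mapsto F(x,z)$ is affine (as for the Lagrangian of an equality-constrained problem), i.e. $\nabla_zF(x,z)$ does not depend on $z$. Isolated path connected component: $\mathcal S_c\subset\mathcal S\subset\mathbb{R}^k$ is an isolated path connected component of $\mathcal S$ if $\mathcal S_c$ is path connected and there is an open neighborhood $\mathcal U$ of $\mathcal S_c$ in $\mathbb{R}^k$ with $\mathcal U\cap\mathcal S=\mathcal S_c$. Stability: a set $\mathcal S$ of equilibria is locally asymptotically stable if (a) for every $\epsilon>0$ there is an open set $W\supset\mathcal S$ such that every trajectory starting in $W$ stays within distance less than $\epsilon$ of $\mathcal S$ for all $t\ge0$, and (b) there is an open set $W\supset\mathcal S$ such that the distance to $\mathcal S$ of every trajectory starting in $W$ tends to $0$ as $t\to\infty$. "Convergence is to a point" means that the trajectories starting in some open set containing $\mathcal S$ each converge to a single point of $\mathcal S$. *)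

theory Defs
  imports "HOL-Analysis.Analysis"
begin

definition grad :: "('a::real_inner \<Rightarrow> real) \<Rightarrow> 'a \<Rightarrow> 'a" where
  "grad f x = (THE g. GDERIV f x :> g)"

definition continuously_differentiable :: "('a::real_inner \<Rightarrow> real) \<Rightarrow> bool" where
  "continuously_differentiable f \<longleftrightarrow>
     (\<exists>G. (\<forall>x. GDERIV f x :> G x) \<and> continuous_on UNIV G)"

definition saddle_field ::
  "('a::real_inner \<times> 'b::real_inner \<Rightarrow> real) \<Rightarrow> 'a \<times> 'b \<Rightarrow> 'a \<times> 'b" where
  "saddle_field F = (\<lambda>(x, z). (- grad (\<lambda>x'. F (x', z)) x, grad (\<lambda>z'. F (x, z')) z))"

definition is_saddle_point ::
  "('a::topological_space \<times> 'b::topological_space \<Rightarrow> real) \<Rightarrow> 'a \<Rightarrow> 'b \<Rightarrow> bool" where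
  "is_saddle_point F xs zs \<longleftrightarrow>
     (\<exists>U V. open U \<and> xs \<in> U \<and> open V \<and> zs \<in> V \<and>
        (\<forall>x\<in>U. \<forall>z\<in>V. F (xs, z) \<le> F (xs, zs) \<and> F (xs, zs) \<le> F (x, zs)))"

definition Saddle ::
  "('a::topological_space \<times> 'b::topological_space \<Rightarrow> real) \<Rightarrow> ('a \<times> 'b) set" where
  "Saddle F = {(x, z). is_saddle_point F x z}"

(* The library's convex_on and concave_on also require their domain to be convex, so the slices
   of U have to be convex. This is no restriction: a neighborhood on which the convexity
   inequalities hold along segments can be shrunk to a ball. *)
definition locally_convex_concave_at ::
  "('a::real_normed_vector \<times> 'b::real_normed_vector \<Rightarrow> real) \<Rightarrow> 'a \<times> 'b \<Rightarrow> bool" where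
  "locally_convex_concave_at F p \<longleftrightarrow>
     (\<exists>U. open U \<and> p \<in> U \<and>
        (\<forall>(xb, zb)\<in>U. convex_on {x. (x, zb) \<in> U} (\<lambda>x. F (x, zb)) \<and>
                       concave_on {z. (xb, z) \<in> U} (\<lambda>z. F (xb, z))))"

definition locally_convex_concave_on ::
  "('a::real_normed_vector \<times> 'b::real_normed_vector \<Rightarrow> real) \<Rightarrow> ('a \<times> 'b) set \<Rightarrow> bool" where
  "locally_convex_concave_on F S \<longleftrightarrow> (\<forall>p\<in>S. locally_convex_concave_at F p)"

(* "Linear in z" in the sense usual for Lagrangians: affine in z for every fixed x. *)
definition linear_in_z ::
  "('a::real_vector \<times> 'b::real_vector \<Rightarrow> real) \<Rightarrow> bool" where
  "linear_in_z F \<longleftrightarrow> (\<forall>x. linear (\<lambda>z. F (x, z) - F (x, 0)))"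

definition isolated_path_component :: "'a::topological_space set \<Rightarrow> 'a set \<Rightarrow> bool" where
  "isolated_path_component Sc S \<longleftrightarrow>
     Sc \<subseteq> S \<and> path_connected Sc \<and> (\<exists>U. open U \<and> Sc \<subseteq> U \<and> U \<inter> S = Sc)"

(* Values of a trajectory at negative times are irrelevant; the derivative at time 0 is
   one-sided. *)
definition trajectory ::
  "('a::real_normed_vector \<Rightarrow> 'a) \<Rightarrow> (real \<Rightarrow> 'a) \<Rightarrow> bool" where
  "trajectory X \<gamma> \<longleftrightarrow> (\<forall>t\<ge>0. (\<gamma> has_vector_derivative X (\<gamma> t)) (at t within {0..}))"

definition equilibria :: "('a::real_normed_vector \<Rightarrow> 'a) \<Rightarrow> 'a set" where
  "equilibria X = {p. X p = 0}"

definition locally_asymptotically_stable ::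
  "('a::real_normed_vector \<Rightarrow> 'a) \<Rightarrow> 'a set \<Rightarrow> bool" where
  "locally_asymptotically_stable X S \<longleftrightarrow>
     S \<subseteq> equilibria X \<and>
     (\<forall>\<epsilon>>0. \<exists>W. open W \<and> S \<subseteq> W \<and>
        (\<forall>\<gamma>. trajectory X \<gamma> \<and> \<gamma> 0 \<in> W \<longrightarrow> (\<forall>t\<ge>0. infdist (\<gamma> t) S < \<epsilon>))) \<and>
     (\<exists>W. open W \<and> S \<subseteq> W \<and>
        (\<forall>\<gamma>. trajectory X \<gamma> \<and> \<gamma> 0 \<in> W \<longrightarrow> ((\<lambda>t. infdist (\<gamma> t) S) \<longlongrightarrow> 0) at_top))"

definition convergence_to_a_point ::
  "('a::real_normed_vector \<Rightarrow> 'a) \<Rightarrow> 'a set \<Rightarrow> bool" where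
  "convergence_to_a_point X S \<longleftrightarrow>
     (\<exists>W. open W \<and> S \<subseteq> W \<and>
        (\<forall>\<gamma>. trajectory X \<gamma> \<and> \<gamma> 0 \<in> W \<longrightarrow> (\<exists>p\<in>S. (\<gamma> \<longlongrightarrow> p) at_top)))"

end

theory Submission
  imports Defs
begin

text \<open>
  Affinity in \<open>z\<close> and convexity in \<open>x\<close> make the squared distance to a saddle point
  \<open>p = (x\<^sub>*, z\<^sub>*)\<close> decrease near \<open>p\<close> at a rate of at least \<open>F (x, z\<^sub>*) - F p \<ge> 0\<close>, so \<open>p\<close> is
  stable. Two applications of Barbalat's lemma replace LaSalle's principle, which would need
  uniqueness of solutions: the first one, to the squared distance, gives
  \<open>F (x, z\<^sub>*) \<rightarrow> F p\<close>; by the level set hypothesis this forces \<open>\<nabla>\<^sub>zF \<rightarrow> 0\<close> and \<open>F \<rightarrow> F p\<close>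
  along the trajectory; the second one, to \<open>F\<close> itself, whose derivative is
  \<open>\<bar>\<nabla>\<^sub>zF\<bar>\<^sup>2 - \<bar>\<nabla>\<^sub>xF\<bar>\<^sup>2\<close>, then gives \<open>\<nabla>\<^sub>xF \<rightarrow> 0\<close>. Every limit point is thus an equilibrium,
  hence a saddle point by convexity, and its own stability makes the trajectory converge to it.
\<close>

section \<open>Bounded trajectories of continuous vector fields\<close>

text \<open>The mean value theorem on a short interval after \<open>t\<close> gives a point where
  \<open>f'\<close> equals a difference quotient of \<open>f\<close>. That quotient is small because
  \<open>f\<close> converges, and uniform continuity carries the bound back to \<open>t\<close>. The
  derivative is asked for only at positive times, since a trajectory has just a one-sided derivative
  at 0.\<close>

lemma barbalat:
  fixes f f' :: "real \<Rightarrow> real"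
  assumes deriv: "\<And>t. t > 0 \<Longrightarrow> (f has_real_derivative f' t) (at t)"
    and uc: "uniformly_continuous_on {0..} f'"
    and lim: "(f \<longlongrightarrow> l) at_top"
  shows "(f' \<longlongrightarrow> 0) at_top"
proof (rule tendstoI)
  fix e :: real
  assume e: "e > 0"
  obtain d where d: "d > 0" and
    dd: "\<And>s t. s \<ge> 0 \<Longrightarrow> t \<ge> 0 \<Longrightarrow> dist s t < d \<Longrightarrow> dist (f' s) (f' t) < e/2"
    using uc e unfolding uniformly_continuous_on_def
    by (metis atLeast_iff half_gt_zero)
  \<comment> \<open>Two values of \<open>f\<close> within \<open>e * d / 8\<close> of
    \<open>l\<close> differ by less than \<open>e * d / 4\<close>; dividing by the interval length
    \<open>d/2\<close> bounds \<open>f'\<close> by \<open>e/2\<close>.\<close>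
  have "e * d / 8 > 0" using e d by simp
  then have "eventually (\<lambda>t. dist (f t) l < e * d / 8) at_top"
    using lim tendstoD by blast
  then obtain T where T: "\<And>t. t \<ge> T \<Longrightarrow> dist (f t) l < e * d / 8"
    unfolding eventually_at_top_linorder by blast
  show "eventually (\<lambda>t. dist (f' t) 0 < e) at_top"
    unfolding eventually_at_top_linorder
  proof (intro exI allI impI)
    fix t assume t: "max T 1 \<le> t"
    have "\<exists>x. t < x \<and> x < t + d/2 \<and> f (t + d/2) - f t = (t + d/2 - t) * f' x"
      by (rule MVT2) (use t d deriv in auto)
    then obtain x where x: "t < x" "x < t + d/2" "f (t + d/2) - f t = d/2 * f' x" by auto
    have "\<bar>f (t + d/2) - f t\<bar> < e * d / 4"
      using T[of t] T[of "t + d/2"] t d unfolding dist_real_def by linarith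
    then have "d * \<bar>f' x\<bar> < d * (e / 2)"
      using x d by (simp add: abs_mult)
    then have "\<bar>f' x\<bar> < e / 2" using d by simp
    moreover have "dist (f' x) (f' t) < e/2"
      using dd[of x t] x t d by (simp add: dist_real_def)
    ultimately show "dist (f' t) 0 < e" unfolding dist_real_def by linarith
  qed
qed

lemma trajectory_at:
  assumes "trajectory X \<gamma>" "t > 0"
  shows "(\<gamma> has_vector_derivative X (\<gamma> t)) (at t)"
proof -
  have "(\<gamma> has_vector_derivative X (\<gamma> t)) (at t within {0..})"
    using assms by (simp add: trajectory_def)
  then have "(\<gamma> has_vector_derivative X (\<gamma> t)) (at t within {0<..})"
    by (rule has_vector_derivative_within_subset) auto
  then show ?thesis
    using assms(2) at_within_open[of t "{0<..}"] by simp
qed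

lemma trajectory_continuous_on:
  "trajectory X \<gamma> \<Longrightarrow> continuous_on {0..} \<gamma>"
  unfolding trajectory_def continuous_on_eq_continuous_within
  by (meson atLeast_iff has_vector_derivative_continuous)

text \<open>The velocity is bounded by the maximum of the continuous field on the compact set, so
  the trajectory is Lipschitz.\<close>

lemma trajectory_uniformly_continuous_on:
  fixes \<gamma> :: "real \<Rightarrow> 'a::real_normed_vector"
  assumes tr: "trajectory X \<gamma>" and K: "compact K" and X: "continuous_on K X"
    and stay: "\<And>t. t \<ge> 0 \<Longrightarrow> \<gamma> t \<in> K"
  shows "uniformly_continuous_on {0..} \<gamma>"
proof -
  have "bounded (X ` K)"
    using compact_continuous_image[OF X K] compact_imp_bounded by blast
  then obtain B where B: "\<And>q. q \<in> K \<Longrightarrow> norm (X q) \<le> B"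
    unfolding bounded_iff by blast
  have "norm (\<gamma> s - \<gamma> t) \<le> B * norm (s - t)" if "s \<in> {0..}" "t \<in> {0..}" for s t
  proof (rule differentiable_bound[where S = "{0..}" and f' = "\<lambda>t h. h *\<^sub>R X (\<gamma> t)"])
    show "(\<gamma> has_derivative (\<lambda>h. h *\<^sub>R X (\<gamma> t))) (at t within {0..})" if "t \<in> {0..}" for t
      using tr that by (simp add: trajectory_def has_vector_derivative_def)
    show "onorm (\<lambda>h. h *\<^sub>R X (\<gamma> t)) \<le> B" if "t \<in> {0..}" for t
      using B[OF stay[of t]] that by (intro onorm_le) (simp add: mult.commute[of B] mult_left_mono)
  qed (use that in auto)
  moreover have "0 \<le> B" using B[OF stay[of 0]] norm_ge_zero order_trans by blast
  ultimately have "B-lipschitz_on {0..} \<gamma>"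
    by (intro lipschitz_onI) (auto simp: dist_norm)
  then show ?thesis by (rule lipschitz_on_uniformly_continuous)
qed

text \<open>Uniform continuity comes for free when the derivative of \<open>W\<close> is a
  continuous function \<Phi> of the state: \<Phi> is uniformly continuous on the compact
  \<open>K\<close>, and so is the trajectory in time.\<close>

lemma barbalat_trajectory:
  fixes \<gamma> :: "real \<Rightarrow> 'a::real_normed_vector" and \<Phi> :: "'a \<Rightarrow> real"
  assumes "trajectory X \<gamma>" "compact K" "continuous_on K X" "\<And>t. t \<ge> 0 \<Longrightarrow> \<gamma> t \<in> K"
    and \<Phi>: "continuous_on K \<Phi>"
    and deriv: "\<And>t. t > 0 \<Longrightarrow> ((\<lambda>t. W (\<gamma> t)) has_real_derivative \<Phi> (\<gamma> t)) (at t)"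
    and lim: "((\<lambda>t. W (\<gamma> t)) \<longlongrightarrow> l) at_top"
  shows "((\<lambda>t. \<Phi> (\<gamma> t)) \<longlongrightarrow> 0) at_top"
proof (rule barbalat[OF deriv _ lim])
  have "uniformly_continuous_on (\<gamma> ` {0..}) \<Phi>"
    using compact_uniformly_continuous[OF \<Phi> assms(2)] assms(4)
    unfolding uniformly_continuous_on_def by (metis atLeast_iff imageE)
  then show "uniformly_continuous_on {0..} (\<lambda>t. \<Phi> (\<gamma> t))"
    using uniformly_continuous_on_compose trajectory_uniformly_continuous_on[OF assms(1-4)]
    by blast
qed

section \<open>Distance to a point as a Lyapunov function\<close>

lemma half_norm_sq_deriv:
  fixes \<gamma> :: "real \<Rightarrow> 'a::real_inner"
  assumes "(\<gamma> has_vector_derivative v) (at t)"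
  shows "((\<lambda>t. (norm (\<gamma> t - p))\<^sup>2 / 2) has_real_derivative inner (\<gamma> t - p) v) (at t)"
proof -
  have "((\<lambda>t. inner (\<gamma> t - p) (\<gamma> t - p) / 2) has_derivative
      (\<lambda>h. (inner (\<gamma> t - p) (h *\<^sub>R v) + inner (h *\<^sub>R v) (\<gamma> t - p)) / 2)) (at t)"
    using assms unfolding has_vector_derivative_def
    by (auto intro!: derivative_eq_intros)
  then show ?thesis
    unfolding has_field_derivative_def power2_norm_eq_inner
    by (simp add: inner_commute mult.commute[of _ "inner _ _"] mult_commute_abs)
qed

text \<open>The sign condition holds only inside the ball, so leaving the ball must be excluded
  first: up to the first exit time the distance does not increase, hence it is still below
  \<open>r\<close> at that time. The starting time \<open>s\<close> is arbitrary so that the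
  estimate can be restarted late, near a limit point.\<close>

lemma trajectory_dist_decreasing:
  fixes p :: "'a::real_inner"
  assumes tr: "trajectory X \<gamma>"
    and neg: "\<And>q. q \<in> ball p r \<Longrightarrow> inner (q - p) (X q) \<le> 0"
    and s: "0 \<le> s" "s \<le> t" and start: "\<gamma> s \<in> ball p r"
  shows "dist p (\<gamma> t) \<le> dist p (\<gamma> s)"
proof -
  have cont: "continuous_on {s..} \<gamma>"
    using trajectory_continuous_on[OF tr] by (rule continuous_on_subset) (use s in auto)
  \<comment> \<open>Membership in the ball is required only strictly between \<open>s\<close> and
    \<open>u\<close>, so that \<open>u\<close> may be the first exit time itself.\<close>
  have mono: "dist p (\<gamma> u) \<le> dist p (\<gamma> s)"
    if u: "s \<le> u" and inb: "\<And>v. s < v \<Longrightarrow> v < u \<Longrightarrow> \<gamma> v \<in> ball p r" for u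
  proof -
    have "(norm (\<gamma> u - p))\<^sup>2 / 2 \<le> (norm (\<gamma> s - p))\<^sup>2 / 2"
    proof (rule DERIV_nonpos_imp_decreasing_open[OF u])
      show "\<exists>y. ((\<lambda>t. (norm (\<gamma> t - p))\<^sup>2 / 2) has_real_derivative y) (at v) \<and> y \<le> 0"
        if "s < v" "v < u" for v
        using half_norm_sq_deriv[OF trajectory_at[OF tr, of v], of p] neg[OF inb[OF that]] that s
        by (intro exI[of _ "inner (\<gamma> v - p) (X (\<gamma> v))"]) simp
      show "continuous_on {s..u} (\<lambda>t. (norm (\<gamma> t - p))\<^sup>2 / 2)"
        by (intro continuous_intros continuous_on_subset[OF cont]) auto
    qed
    then show ?thesis by (simp add: dist_norm norm_minus_commute)
  qed
  have "\<gamma> v \<in> ball p r" if v: "s \<le> v" for v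
  proof (rule ccontr)
    assume out: "\<gamma> v \<notin> ball p r"
    \<comment> \<open>Times spent outside the ball. As \<open>A\<close> is closed, its infimum is
      attained and is the first exit time.\<close>
    define A where "A = {u \<in> {s..v}. r \<le> dist p (\<gamma> u)}"
    have "closed A" unfolding A_def
      by (intro continuous_on_closed_Collect_le continuous_on_dist continuous_on_const
          continuous_on_subset[OF cont] closed_atLeastAtMost) auto
    moreover have "v \<in> A" using v out by (auto simp: A_def)
    moreover have bdd: "bdd_below A" by (auto simp: A_def)
    ultimately have I: "Inf A \<in> A" using closed_contains_Inf[of A] by blast
    have "\<gamma> u \<in> ball p r" if "s < u" "u < Inf A" for u
    proof -
      have "u \<notin> A" using that cInf_lower[OF _ bdd, of u] by linarith
      moreover have "Inf A \<le> v" using I by (simp add: A_def)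
      ultimately show ?thesis using that by (auto simp: A_def)
    qed
    then have "dist p (\<gamma> (Inf A)) \<le> dist p (\<gamma> s)"
      using mono[of "Inf A"] I by (simp add: A_def)
    then show False using I start by (auto simp: A_def)
  qed
  then show ?thesis by (intro mono) (use s in auto)
qed

lemma trajectory_dist_converges:
  fixes p :: "'a::real_inner"
  assumes tr: "trajectory X \<gamma>"
    and neg: "\<And>q. q \<in> ball p r \<Longrightarrow> inner (q - p) (X q) \<le> 0"
    and start: "\<gamma> 0 \<in> ball p r"
  shows "\<exists>l. ((\<lambda>t. dist p (\<gamma> t)) \<longlongrightarrow> l) at_top"
proof -
  define D where "D t = dist p (\<gamma> t)" for t
  have D0: "D t \<le> D 0" if "0 \<le> t" for t
    using trajectory_dist_decreasing[OF tr neg _ _ start] that by (simp add: D_def)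
  \<comment> \<open>\<open>D0\<close> keeps \<open>\<gamma> s\<close> in the ball, so the previous
    lemma applies from time \<open>s\<close> on.\<close>
  have dec: "D t \<le> D s" if "0 \<le> s" "s \<le> t" for s t
    unfolding D_def
    by (rule trajectory_dist_decreasing[OF tr neg that]) (use D0[of s] that start in \<open>auto simp: D_def\<close>)
  define l where "l = (INF t\<in>{0..}. D t)"
  have bdd: "bdd_below (D ` {0..})" by (rule bdd_belowI[of _ 0]) (auto simp: D_def)
  have "(D \<longlongrightarrow> l) at_top"
  proof (rule order_tendstoI)
    fix a assume "a < l"
    then show "eventually (\<lambda>t. a < D t) at_top"
      unfolding eventually_at_top_linorder l_def
      by (metis atLeast_iff bdd cINF_lower less_le_trans)
  next
    fix a assume "l < a"
    then obtain s where "s \<ge> 0" "D s < a"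
      unfolding l_def by (subst (asm) cINF_less_iff) (auto simp: bdd)
    then show "eventually (\<lambda>t. D t < a) at_top"
      unfolding eventually_at_top_linorder using dec le_less_trans by blast
  qed
  then show ?thesis by (auto simp: D_def[abs_def])
qed

text \<open>An inclusion of zero sets becomes quantitative by compactness: on the part of
  \<open>K\<close> where \<open>\<bar>k\<bar>\<close> is at least \<open>e\<close>,
  \<open>\<bar>f\<bar>\<close> has a positive minimum, and the trajectory leaves that part once
  \<open>\<bar>f\<bar>\<close> falls below it. No rate relating \<open>f\<close> and
  \<open>k\<close> is required.\<close>

lemma tendsto_zero_of_zeros:
  fixes f k :: "'a::metric_space \<Rightarrow> real"
  assumes K: "compact K" and f: "continuous_on K f" and k: "continuous_on K k"
    and zero: "\<And>q. q \<in> K \<Longrightarrow> f q = 0 \<Longrightarrow> k q = 0"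
    and stay: "\<And>t::real. t \<ge> 0 \<Longrightarrow> \<gamma> t \<in> K"
    and lim: "((\<lambda>t. f (\<gamma> t)) \<longlongrightarrow> 0) at_top"
  shows "((\<lambda>t. k (\<gamma> t)) \<longlongrightarrow> 0) at_top"
proof (rule tendstoI)
  fix e :: real
  assume e: "e > 0"
  define A where "A = {q \<in> K. e \<le> \<bar>k q\<bar>}"
  have closed: "closed A" unfolding A_def
    by (intro continuous_on_closed_Collect_le continuous_intros k compact_imp_closed K)
  have "compact A"
    using compact_Int_closed[OF K closed] by (simp add: A_def Int_def conj_commute cong: conj_cong)
  moreover have "continuous_on A (\<lambda>q. \<bar>f q\<bar>)"
    by (intro continuous_intros continuous_on_subset[OF f]) (auto simp: A_def)
  ultimately have "\<exists>m>0. \<forall>q\<in>A. m \<le> \<bar>f q\<bar>"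
  proof (cases "A = {}")
    case False
    then obtain q0 where "q0 \<in> A" "\<forall>q\<in>A. \<bar>f q0\<bar> \<le> \<bar>f q\<bar>"
      using continuous_attains_inf[OF \<open>compact A\<close> False \<open>continuous_on A _\<close>] by blast
    moreover have "f q0 \<noteq> 0" using zero[of q0] \<open>q0 \<in> A\<close> e by (auto simp: A_def)
    ultimately show ?thesis by (metis zero_less_abs_iff)
  qed (auto intro: exI[of _ 1])
  then obtain m where m: "m > 0" "\<And>q. q \<in> A \<Longrightarrow> m \<le> \<bar>f q\<bar>" by blast
  have "eventually (\<lambda>t. dist (f (\<gamma> t)) 0 < m) at_top" using lim m(1) tendstoD by blast
  moreover have "eventually (\<lambda>t::real. t \<ge> 0) at_top" by (rule eventually_ge_at_top)
  ultimately show "eventually (\<lambda>t. dist (k (\<gamma> t)) 0 < e) at_top"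
  proof eventually_elim
    case (elim t)
    then show ?case using m(2)[of "\<gamma> t"] stay[of t] by (force simp: A_def)
  qed
qed

lemma bounded_trajectory_limit_point:
  fixes \<gamma> :: "real \<Rightarrow> 'a::metric_space"
  assumes "compact K" "\<And>t. t \<ge> 0 \<Longrightarrow> \<gamma> t \<in> K"
  obtains q \<tau> where "q \<in> K" "filterlim \<tau> at_top sequentially" "(\<lambda>n::nat. \<gamma> (\<tau> n)) \<longlonglongrightarrow> q"
proof -
  have "\<forall>n. \<gamma> (real n) \<in> K" using assms(2) by simp
  then obtain q \<rho> where "q \<in> K" "strict_mono \<rho>" "((\<lambda>n. \<gamma> (real n)) \<circ> \<rho>) \<longlonglongrightarrow> q"
    using assms(1) unfolding compact_def by metis
  moreover have "filterlim (\<lambda>n. real (\<rho> n)) at_top sequentially"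
    using filterlim_compose[OF filterlim_real_sequentially filterlim_subseq] \<open>strict_mono \<rho>\<close> by blast
  ultimately show ?thesis using that[of q "\<lambda>n. real (\<rho> n)"] by (simp add: o_def)
qed

section \<open>Convexity and gradients\<close>

text \<open>Restriction to the line through \<open>x\<close> and \<open>y\<close> reduces this to
  the tangent inequality for a convex function of one real variable.\<close>

lemma convex_on_above_gradient:
  fixes f :: "'a::real_inner \<Rightarrow> real"
  assumes conv: "convex_on S f" and S: "open S" "x \<in> S" "y \<in> S"
    and grad: "GDERIV f x :> g"
  shows "f x + inner (y - x) g \<le> f y"
proof -
  define \<phi> where "\<phi> t = f (x + t *\<^sub>R (y - x))" for t :: real
  define A where "A = {t::real. x + t *\<^sub>R (y - x) \<in> S}"
  have "open ((\<lambda>t::real. x + t *\<^sub>R (y - x)) -` S)"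
    using S(1) by (intro open_vimage continuous_intros)
  then have openA: "open A" by (simp add: A_def vimage_def)
  \<comment> \<open>The parametrization of the line commutes with convex combinations; both the
    convexity of \<open>A\<close> and that of \<phi> follow from this.\<close>
  have comb: "x + ((1 - u) *\<^sub>R s + u *\<^sub>R t) *\<^sub>R (y - x) =
      (1 - u) *\<^sub>R (x + s *\<^sub>R (y - x)) + u *\<^sub>R (x + t *\<^sub>R (y - x))" for s t u :: real
    by (simp add: algebra_simps)
  have "convex S" using conv by (simp add: convex_on_def)
  then have "convex A"
    unfolding convex_alt A_def mem_Collect_eq comb by blast
  have "convex_on A \<phi>"
  proof (rule convex_onI[OF _ \<open>convex A\<close>])
    fix t u v :: real
    assume "0 < t" "t < 1" "u \<in> A" "v \<in> A"
    then show "\<phi> ((1 - t) *\<^sub>R u + t *\<^sub>R v) \<le> (1 - t) * \<phi> u + t * \<phi> v"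
      unfolding \<phi>_def comb A_def using convex_onD[OF conv, of t] by simp
  qed
  moreover have "(\<phi> has_real_derivative inner (y - x) g) (at 0 within A)"
  proof -
    have "((\<lambda>t::real. x + t *\<^sub>R (y - x)) has_derivative (\<lambda>t. t *\<^sub>R (y - x))) (at 0)"
      by (auto intro!: derivative_eq_intros)
    moreover have "(f has_derivative (\<lambda>h. inner h g)) (at (x + 0 *\<^sub>R (y - x)))"
      using grad by (simp add: gderiv_def)
    ultimately have "(\<phi> has_derivative (\<lambda>t. inner (t *\<^sub>R (y - x)) g)) (at 0)"
      unfolding \<phi>_def by (rule has_derivative_compose)
    then have "(\<phi> has_real_derivative inner (y - x) g) (at 0)"
      by (simp add: has_field_derivative_def mult_commute_abs)
    then show ?thesis by (rule has_field_derivative_at_within)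
  qed
  moreover have "0 \<in> interior A" "1 \<in> A"
    using S by (simp_all add: interior_open[OF openA]) (simp_all add: A_def)
  ultimately have "\<phi> 1 - \<phi> 0 \<ge> inner (y - x) g * (1 - 0)"
    using \<open>convex A\<close> by (intro convex_on_imp_above_tangent) (auto simp: convex_connected)
  then show ?thesis by (simp add: \<phi>_def)
qed

lemma grad_eqI:
  assumes "GDERIV f x :> g"
  shows "grad f x = g"
  unfolding grad_def
proof (rule the_equality[where a = g])
  show "GDERIV f x :> g" by (fact assms)
next
  fix g' assume "GDERIV f x :> g'"
  then have "(\<lambda>h. inner h g') = (\<lambda>h. inner h g)"
    using assms unfolding gderiv_def by (rule has_derivative_unique)
  then show "g' = g" by (metis inner_commute vector_eq_rdot)
qed

section \<open>Saddle-point dynamics\<close>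

text \<open>The joint gradient is a parameter \<open>G\<close>, so that the partial gradients are
  its components. Convexity and the level set condition stay outside the locale because they are
  used only on balls around particular saddle points.\<close>

locale affine_saddle_problem =
  fixes F :: "'a::euclidean_space \<times> 'b::euclidean_space \<Rightarrow> real"
    and G :: "'a \<times> 'b \<Rightarrow> 'a \<times> 'b"
  assumes gradient: "\<And>p. GDERIV F p :> G p"
    and continuous_gradient: "continuous_on UNIV G"
    and linear_z: "linear_in_z F"
begin

section \<open>Partial gradients and affinity in the second variable\<close>

lemma gradient_x: "GDERIV (\<lambda>x. F (x, z)) x :> fst (G (x, z))"
proof -
  have "((\<lambda>x. (x, z)) has_derivative (\<lambda>h. (h, 0))) (at x)"
    by (auto intro!: derivative_eq_intros)
  from has_derivative_compose[OF this] show ?thesis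
    using gradient[of "(x, z)"] unfolding gderiv_def by (fastforce simp: inner_prod_def)
qed

lemma gradient_z: "GDERIV (\<lambda>z. F (x, z)) z :> snd (G (x, z))"
proof -
  have "((\<lambda>z. (x, z)) has_derivative (\<lambda>h. (0, h))) (at z)"
    by (auto intro!: derivative_eq_intros)
  from has_derivative_compose[OF this] show ?thesis
    using gradient[of "(x, z)"] unfolding gderiv_def by (fastforce simp: inner_prod_def)
qed

lemma saddle_field_eq: "saddle_field F p = (- fst (G p), snd (G p))"
  by (cases p) (simp add: saddle_field_def grad_eqI[OF gradient_x] grad_eqI[OF gradient_z])

lemma continuous_on_G [continuous_intros]:
  "continuous_on A f \<Longrightarrow> continuous_on A (\<lambda>u. G (f u))"
  by (rule continuous_on_compose2[OF continuous_gradient]) auto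

lemma continuous_on_saddle_field [continuous_intros]:
  "continuous_on A f \<Longrightarrow> continuous_on A (\<lambda>u. saddle_field F (f u))"
  unfolding saddle_field_eq by (intro continuous_intros)

lemma continuous_on_F [continuous_intros]:
  "continuous_on A f \<Longrightarrow> continuous_on A (\<lambda>u. F (f u))"
proof (rule continuous_on_compose2[of UNIV F])
  show "continuous_on UNIV F"
    by (meson gradient gderiv_def continuous_at_imp_continuous_on has_derivative_continuous)
qed auto

text \<open>A linear map is its own derivative at every point, so the slope in \<open>z\<close> can
  be read off at any base point. Later steps expand around the saddle point as well as around the
  current state.\<close>

lemma affine_z: "F (x, z') = F (x, z) + inner (z' - z) (snd (G (x, z)))"
proof -
  define L where "L z = F (x, z) - F (x, 0)" for z
  have lin: "linear L" using linear_z by (simp add: linear_in_z_def L_def[abs_def])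
  then have "(L has_derivative L) (at z)"
    by (simp add: linear_imp_has_derivative)
  moreover have "(L has_derivative (\<lambda>h. inner h (snd (G (x, z))))) (at z)"
    using gradient_z[of x z] unfolding L_def gderiv_def
    by (auto intro!: derivative_eq_intros)
  ultimately have "L = (\<lambda>h. inner h (snd (G (x, z))))"
    by (rule has_derivative_unique)
  then have "L (z' - z) = inner (z' - z) (snd (G (x, z)))" by metis
  then show ?thesis using linear_diff[OF lin, of z' z] by (simp add: L_def)
qed

section \<open>Saddle points and the local decay estimate\<close>

lemma saddle_imp_gradient_zero:
  assumes "p \<in> Saddle F"
  shows "G p = 0"
proof -
  obtain xs zs where p: "p = (xs, zs)" by (cases p)
  obtain U V where UV: "open U" "xs \<in> U" "open V" "zs \<in> V"
    "\<And>x z. x \<in> U \<Longrightarrow> z \<in> V \<Longrightarrow> F (xs, z) \<le> F (xs, zs) \<and> F (xs, zs) \<le> F (x, zs)"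
    using assms unfolding p Saddle_def is_saddle_point_def by blast
  have "(\<lambda>h. inner h (fst (G p))) = (\<lambda>h. 0)"
    by (rule differential_zero_maxmin[OF UV(2,1), of "\<lambda>x. F (x, zs)"])
      (use gradient_x UV in \<open>auto simp: p gderiv_def\<close>)
  moreover have "(\<lambda>h. inner h (snd (G p))) = (\<lambda>h. 0)"
    by (rule differential_zero_maxmin[OF UV(4,3), of "\<lambda>z. F (xs, z)"])
      (use gradient_z UV in \<open>auto simp: p gderiv_def\<close>)
  ultimately show ?thesis
    by (metis inner_eq_zero_iff prod.collapse zero_prod_def)
qed

lemma saddle_imp_equilibrium: "Saddle F \<subseteq> equilibria (saddle_field F)"
  by (auto simp: equilibria_def saddle_field_eq zero_prod_def dest!: saddle_imp_gradient_zero)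

text \<open>With \<open>p = (xs, zs)\<close> and \<open>q = (x, z)\<close>, convexity bounds the
  \<open>x\<close> part of the inner product by \<open>F (xs, z) - F q\<close>, and affinity makes
  the \<open>z\<close> part equal to \<open>F q - F (x, zs)\<close>. The terms \<open>F q\<close>
  cancel, and \<open>F (xs, z) = F p\<close> because the slope in \<open>z\<close> vanishes at
  \<open>xs\<close>.\<close>

lemma saddle_neighbourhood:
  assumes sad: "p \<in> Saddle F" and cc: "locally_convex_concave_at F p"
  obtains r where "r > 0"
    and "\<And>q. q \<in> ball p r \<Longrightarrow> F p \<le> F (fst q, snd p)"
    and "\<And>q. q \<in> ball p r \<Longrightarrow> inner (q - p) (saddle_field F q) \<le> F p - F (fst q, snd p)"
    and "\<And>q. q \<in> ball p r \<Longrightarrow> G q = 0 \<Longrightarrow> q \<in> Saddle F"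
proof -
  obtain xs zs where p: "p = (xs, zs)" by (cases p)
  obtain U where U: "open U" "p \<in> U"
    and conv: "\<And>x z. (x, z) \<in> U \<Longrightarrow> convex_on {x. (x, z) \<in> U} (\<lambda>x. F (x, z))"
    using cc unfolding locally_convex_concave_at_def by blast
  obtain A where A: "open A" "xs \<in> A" "\<And>x. x \<in> A \<Longrightarrow> F p \<le> F (x, zs)"
    using sad unfolding p Saddle_def is_saddle_point_def by blast
  have "open (U \<inter> A \<times> UNIV)" "p \<in> U \<inter> A \<times> UNIV"
    using U A by (auto simp: p intro!: open_Int open_Times)
  then obtain r where r: "r > 0" "ball p r \<subseteq> U \<inter> A \<times> UNIV"
    unfolding open_contains_ball by blast
  have above: "F (x, z) + inner (y - x) (fst (G (x, z))) \<le> F (y, z)"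
    if "(x, z) \<in> U" "(y, z) \<in> U" for x y z
  proof (rule convex_on_above_gradient[OF conv[OF that(1)] _ _ _ gradient_x])
    have "open ((\<lambda>x. (x, z)) -` U)" using U(1) by (intro open_vimage continuous_intros)
    then show "open {x. (x, z) \<in> U}" by (simp add: vimage_def)
  qed (use that in auto)
  show ?thesis
  proof (rule that[OF r(1)])
    fix q assume q: "q \<in> ball p r"
    obtain x z where xz: "q = (x, z)" by (cases q)
    have "x \<in> A" using q r xz by auto
    then show "F p \<le> F (fst q, snd p)" using A(3) by (simp add: xz p)
    \<comment> \<open>The tangent inequality compares \<open>q\<close> with \<open>(xs, z)\<close>,
      which is no farther from \<open>p\<close> than \<open>q\<close> and therefore lies in
      \<open>U\<close> too.\<close>
    have "dist p (xs, z) \<le> dist p q" by (simp add: p xz dist_Pair_Pair real_le_rsqrt)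
    then have "(xs, z) \<in> U" using q r(2) by auto
    moreover have "(x, z) \<in> U" using q r(2) xz by auto
    ultimately have "inner (xs - x) (fst (G q)) \<le> F (xs, z) - F q"
      using above[of x z xs] by (simp add: xz)
    moreover have "F (xs, z) = F p"
      using affine_z[of xs z zs] saddle_imp_gradient_zero[OF sad] by (simp add: p)
    moreover have "inner (z - zs) (snd (G q)) = F q - F (x, zs)"
      using affine_z[of x zs z] by (simp add: xz inner_diff_left)
    ultimately show "inner (q - p) (saddle_field F q) \<le> F p - F (fst q, snd p)"
      by (simp add: xz p saddle_field_eq inner_prod_def inner_diff_left)
  next
    fix q assume q: "q \<in> ball p r" "G q = 0"
    obtain x z where xz: "q = (x, z)" by (cases q)
    have qU: "(x, z) \<in> U" using q r xz by auto
    have "open ((\<lambda>x. (x, z)) -` U)" using U(1) by (intro open_vimage continuous_intros)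
    moreover have "x \<in> (\<lambda>x. (x, z)) -` U" using qU by simp
    \<comment> \<open>Where \<open>G\<close> vanishes, the tangent inequality makes \<open>x\<close>
      a minimum on its slice of \<open>U\<close>, while \<open>F\<close> is constant in
      \<open>z\<close>.\<close>
    moreover have "F (x, z) \<le> F (y, z)" if "y \<in> (\<lambda>x. (x, z)) -` U" for y
      using above[OF qU, of y] that q by (simp add: xz)
    moreover have "F (x, z') \<le> F (x, z)" for z'
      using affine_z[of x z' z] q by (simp add: xz)
    ultimately show "q \<in> Saddle F"
      unfolding Saddle_def is_saddle_point_def xz by blast
  qed
qed

section \<open>Convergence of trajectories near a saddle point\<close>

lemma F_deriv_along_trajectory:
  assumes "trajectory (saddle_field F) \<gamma>" "t > 0"
  shows "((\<lambda>t. F (\<gamma> t)) has_real_derivative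
    (norm (snd (G (\<gamma> t))))\<^sup>2 - (norm (fst (G (\<gamma> t))))\<^sup>2) (at t)"
proof -
  have "(\<gamma> has_derivative (\<lambda>h. h *\<^sub>R saddle_field F (\<gamma> t))) (at t)"
    using trajectory_at[OF assms] by (simp add: has_vector_derivative_def)
  moreover have "(F has_derivative (\<lambda>h. inner h (G (\<gamma> t)))) (at (\<gamma> t))"
    using gradient by (simp add: gderiv_def)
  ultimately have "((\<lambda>t. F (\<gamma> t)) has_derivative
      (\<lambda>h. inner (h *\<^sub>R saddle_field F (\<gamma> t)) (G (\<gamma> t)))) (at t)"
    by (rule has_derivative_compose)
  moreover have "inner (h *\<^sub>R saddle_field F (\<gamma> t)) (G (\<gamma> t)) =
      ((norm (snd (G (\<gamma> t))))\<^sup>2 - (norm (fst (G (\<gamma> t))))\<^sup>2) * h" for h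
    by (simp add: saddle_field_eq inner_prod_def power2_norm_eq_inner algebra_simps)
  then have "(\<lambda>h. inner (h *\<^sub>R saddle_field F (\<gamma> t)) (G (\<gamma> t))) =
      (*) ((norm (snd (G (\<gamma> t))))\<^sup>2 - (norm (fst (G (\<gamma> t))))\<^sup>2)"
    by blast
  ultimately show ?thesis unfolding has_field_derivative_def by metis
qed

text \<open>The last four hypotheses are the conclusions of \<open>saddle_neighbourhood\<close> and
  the level set condition on a common ball. The limit is located in that ball so that an isolating
  neighborhood can later place it in the component.\<close>

lemma trajectory_tendsto_saddle:
  assumes tr: "trajectory (saddle_field F) \<gamma>" and start: "\<gamma> 0 \<in> ball p r"
    and cc: "locally_convex_concave_on F (Saddle F)"
    and sad: "p \<in> Saddle F"
    and ge: "\<And>q. q \<in> ball p r \<Longrightarrow> F p \<le> F (fst q, snd p)"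
    and decay: "\<And>q. q \<in> ball p r \<Longrightarrow> inner (q - p) (saddle_field F q) \<le> F p - F (fst q, snd p)"
    and equil: "\<And>q. q \<in> ball p r \<Longrightarrow> G q = 0 \<Longrightarrow> q \<in> Saddle F"
    and level: "\<And>q. q \<in> ball p r \<Longrightarrow> F (fst q, snd p) = F p \<Longrightarrow> (fst q, snd p) \<in> Saddle F"
  shows "\<exists>q \<in> Saddle F \<inter> ball p r. (\<gamma> \<longlongrightarrow> q) at_top"
proof -
  \<comment> \<open>The distance to \<open>p\<close> never exceeds its initial value, so this closed
    ball traps the trajectory; it is compact and lies inside the open ball.\<close>
  define K where "K = cball p (dist p (\<gamma> 0))"
  have K: "compact K" "K \<subseteq> ball p r"
    using start by (auto simp: K_def)
  have neg: "inner (q - p) (saddle_field F q) \<le> 0" if "q \<in> ball p r" for q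
    using ge[OF that] decay[OF that] by simp
  have stay: "\<gamma> t \<in> K" if "t \<ge> 0" for t
    using trajectory_dist_decreasing[OF tr neg _ _ start] that by (simp add: K_def)
  define g where "g q = F (fst q, snd p) - F p" for q :: "'a \<times> 'b"
  have cont_g: "continuous_on K g"
    unfolding g_def
    by (intro continuous_intros)
  \<comment> \<open>The level set condition makes \<open>(fst q, snd p)\<close> a saddle point, so
    the slope in \<open>z\<close> over \<open>fst q\<close> is zero. Moving from
    \<open>snd q\<close> by \<open>snd (G q)\<close> changes \<open>F\<close> by the squared norm of
    \<open>snd (G q)\<close>, which must then vanish.\<close>
  have zero_z: "snd (G q) = 0" if "q \<in> K" "g q = 0" for q
  proof -
    have "G (fst q, snd p) = 0"
      using level[of q] that K(2) by (intro saddle_imp_gradient_zero) (auto simp: g_def)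
    then have "F (fst q, z) = F (fst q, snd q)" for z
      using affine_z[of "fst q" z "snd p"] affine_z[of "fst q" "snd q" "snd p"] by simp
    from affine_z[of "fst q" "snd q + snd (G q)" "snd q"] this show ?thesis by simp
  qed
  obtain l where "((\<lambda>t. dist p (\<gamma> t)) \<longlongrightarrow> l) at_top"
    using trajectory_dist_converges[OF tr neg start] by blast
  then have "((\<lambda>t. (dist p (\<gamma> t))\<^sup>2 / 2) \<longlongrightarrow> l\<^sup>2 / 2) at_top"
    by (intro tendsto_intros) auto
  then have lim_dist: "((\<lambda>t. (norm (\<gamma> t - p))\<^sup>2 / 2) \<longlongrightarrow> l\<^sup>2 / 2) at_top"
    by (simp add: dist_norm norm_minus_commute)
  have lim1: "((\<lambda>t. inner (\<gamma> t - p) (saddle_field F (\<gamma> t))) \<longlongrightarrow> 0) at_top"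
  proof (rule barbalat_trajectory[where \<Phi> = "\<lambda>q. inner (q - p) (saddle_field F q)"
        and W = "\<lambda>q. (norm (q - p))\<^sup>2 / 2", OF tr K(1) _ stay _ _ lim_dist])
    show "continuous_on K (saddle_field F)"
      "continuous_on K (\<lambda>q. inner (q - p) (saddle_field F q))"
      by (intro continuous_intros)+
  qed (assumption | rule half_norm_sq_deriv[OF trajectory_at[OF tr]], assumption)+
  have lim_g: "((\<lambda>t. g (\<gamma> t)) \<longlongrightarrow> 0) at_top"
  proof (rule tendsto_sandwich[OF _ _ tendsto_const])
    show "((\<lambda>t. - inner (\<gamma> t - p) (saddle_field F (\<gamma> t))) \<longlongrightarrow> 0) at_top"
      using tendsto_minus[OF lim1] by simp
    have in_ball: "\<gamma> t \<in> ball p r" if "t \<ge> 0" for t using stay that K(2) by blast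
    show "eventually (\<lambda>t. 0 \<le> g (\<gamma> t)) at_top"
      using eventually_ge_at_top[of 0] by eventually_elim (use ge in_ball in \<open>simp add: g_def\<close>)
    show "eventually (\<lambda>t. g (\<gamma> t) \<le> - inner (\<gamma> t - p) (saddle_field F (\<gamma> t))) at_top"
      using eventually_ge_at_top[of 0]
    proof eventually_elim
      case (elim t)
      then show ?case using decay[OF in_ball[of t]] by (simp add: g_def)
    qed
  qed
  \<comment> \<open>Although \<open>F\<close> need not be monotone along the trajectory, it
    converges: at a zero of \<open>g\<close> in \<open>K\<close> it is constant in \<open>z\<close>,
    hence equal to \<open>F p\<close>.\<close>
  have "((\<lambda>t. F (\<gamma> t) - F p) \<longlongrightarrow> 0) at_top"
  proof (rule tendsto_zero_of_zeros[OF K(1) cont_g _ _ stay lim_g])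
    show "continuous_on K (\<lambda>q. F q - F p)" by (intro continuous_intros)
    show "F q - F p = 0" if "q \<in> K" "g q = 0" for q
      using affine_z[of "fst q" "snd p" "snd q"] zero_z[OF that] that(2) by (simp add: g_def)
  qed
  then have lim_F: "((\<lambda>t. F (\<gamma> t)) \<longlongrightarrow> F p) at_top" by (rule Lim_null[THEN iffD2])
  have lim2: "((\<lambda>t. (norm (snd (G (\<gamma> t))))\<^sup>2 - (norm (fst (G (\<gamma> t))))\<^sup>2) \<longlongrightarrow> 0) at_top"
  proof (rule barbalat_trajectory[where \<Phi> = "\<lambda>q. (norm (snd (G q)))\<^sup>2 - (norm (fst (G q)))\<^sup>2"
        and W = F, OF tr K(1) _ stay _ _ lim_F])
    show "continuous_on K (saddle_field F)"
      "continuous_on K (\<lambda>q. (norm (snd (G q)))\<^sup>2 - (norm (fst (G q)))\<^sup>2)"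
      by (intro continuous_intros)+
  qed (assumption | rule F_deriv_along_trajectory[OF tr], assumption)+
  obtain q \<tau> where q: "q \<in> K" "filterlim \<tau> at_top sequentially" "(\<lambda>n::nat. \<gamma> (\<tau> n)) \<longlonglongrightarrow> q"
    using bounded_trajectory_limit_point[where \<gamma> = \<gamma>, OF K(1)] stay by metis
  have limit_zero: "f q = 0"
    if "((\<lambda>t. f (\<gamma> t)) \<longlongrightarrow> 0) at_top" "continuous_on UNIV f" for f :: "'a \<times> 'b \<Rightarrow> real"
  proof (rule LIMSEQ_unique)
    show "(\<lambda>n. f (\<gamma> (\<tau> n))) \<longlonglongrightarrow> 0" using filterlim_compose[OF that(1) q(2)] .
    show "(\<lambda>n. f (\<gamma> (\<tau> n))) \<longlonglongrightarrow> f q"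
      using that(2) q(3) by (auto intro: continuous_on_tendsto_compose)
  qed
  \<comment> \<open>Both limits are evaluated at the limit point: the first gives a zero
    \<open>z\<close>-gradient, and then the second gives a zero \<open>x\<close>-gradient.\<close>
  have "g q = 0"
    unfolding g_def
    by (intro limit_zero continuous_intros lim_g[unfolded g_def])
  then have "snd (G q) = 0" using zero_z q by blast
  moreover have "(norm (snd (G q)))\<^sup>2 - (norm (fst (G q)))\<^sup>2 = 0"
    by (intro limit_zero[OF lim2] continuous_intros)
  ultimately have "G q = 0" by (simp add: prod_eq_iff)
  then have q_sad: "q \<in> Saddle F" using equil q(1) K(2) by blast
  then have cc_q: "locally_convex_concave_at F q"
    using cc by (simp add: locally_convex_concave_on_def)
  obtain \<rho> where \<rho>: "\<rho> > 0"
    "\<And>u. u \<in> ball q \<rho> \<Longrightarrow> F q \<le> F (fst u, snd q)"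
    "\<And>u. u \<in> ball q \<rho> \<Longrightarrow> inner (u - q) (saddle_field F u) \<le> F q - F (fst u, snd q)"
    using saddle_neighbourhood[OF q_sad cc_q] by metis
  have neg_q: "inner (u - q) (saddle_field F u) \<le> 0" if "u \<in> ball q \<rho>" for u
    using \<rho>(2,3)[OF that] by simp
  have "(\<gamma> \<longlongrightarrow> q) at_top"
  proof (rule tendstoI)
    fix e :: real assume "e > 0"
    \<comment> \<open>One visit this close to \<open>q\<close> suffices: within \<rho> the distance
      to \<open>q\<close> no longer increases, so it stays below \<open>e\<close> from then
      on.\<close>
    then have "eventually (\<lambda>n. dist (\<gamma> (\<tau> n)) q < min e \<rho>) sequentially"
      using q(3) \<rho>(1) by (intro tendstoD) auto
    moreover have "eventually (\<lambda>n. \<tau> n \<ge> 0) sequentially"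
      using q(2) by (simp add: filterlim_at_top)
    ultimately have "eventually (\<lambda>n. dist (\<gamma> (\<tau> n)) q < min e \<rho> \<and> \<tau> n \<ge> 0) sequentially"
      by eventually_elim simp
    then obtain n where n: "dist (\<gamma> (\<tau> n)) q < min e \<rho>" "\<tau> n \<ge> 0"
      using eventually_happens'[OF sequentially_bot] by blast
    then have start_q: "\<gamma> (\<tau> n) \<in> ball q \<rho>" by (simp add: dist_commute)
    have "dist (\<gamma> t) q < e" if "t \<ge> \<tau> n" for t
      using trajectory_dist_decreasing[OF tr neg_q n(2) that start_q] n(1)
      by (simp add: dist_commute)
    then show "eventually (\<lambda>t. dist (\<gamma> t) q < e) at_top"
      unfolding eventually_at_top_linorder by blast
  qed
  then show ?thesis using q_sad q(1) K(2) by blast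
qed

end

section \<open>Isolated components of the saddle set\<close>

theorem proposition4p4:
  fixes F :: "(real ^ 'n) \<times> (real ^ 'm) \<Rightarrow> real"
  assumes C1: "continuously_differentiable F"
    and nonempty: "Saddle F \<noteq> {}"
    and convex_concave: "locally_convex_concave_on F (Saddle F)"
    and lin: "linear_in_z F"
    and level: "\<And>xs zs. (xs, zs) \<in> Saddle F \<Longrightarrow>
      \<exists>U. open U \<and> xs \<in> U \<and> (\<forall>x\<in>U. F (x, zs) = F (xs, zs) \<longrightarrow> (x, zs) \<in> Saddle F)"
  shows "\<forall>Sc. isolated_path_component Sc (Saddle F) \<longrightarrow>
    locally_asymptotically_stable (saddle_field F) Sc \<and>
    convergence_to_a_point (saddle_field F) Sc"
proof (intro allI impI)
  fix Sc assume "isolated_path_component Sc (Saddle F)"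
  then obtain U where sub: "Sc \<subseteq> Saddle F" and U: "open U" "Sc \<subseteq> U" "U \<inter> Saddle F = Sc"
    unfolding isolated_path_component_def by blast
  obtain G where G: "\<And>p. GDERIV F p :> G p" "continuous_on UNIV G"
    using C1 unfolding continuously_differentiable_def by blast
  interpret affine_saddle_problem F G
    by unfold_locales (use G lin in auto)
  have local: "\<exists>r>0. r \<le> e \<and> (\<forall>\<gamma>. trajectory (saddle_field F) \<gamma> \<and> \<gamma> 0 \<in> ball p r \<longrightarrow>
      (\<forall>t\<ge>0. dist p (\<gamma> t) < r) \<and> (\<exists>q\<in>Sc. (\<gamma> \<longlongrightarrow> q) at_top))"
    if p: "p \<in> Sc" and e: "e > 0" for p and e :: real
  proof -
    have sad: "p \<in> Saddle F" using p sub by blast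
    then have cc_p: "locally_convex_concave_at F p"
      using convex_concave by (simp add: locally_convex_concave_on_def)
    obtain r1 where r1: "r1 > 0"
      "\<And>q. q \<in> ball p r1 \<Longrightarrow> F p \<le> F (fst q, snd p)"
      "\<And>q. q \<in> ball p r1 \<Longrightarrow> inner (q - p) (saddle_field F q) \<le> F p - F (fst q, snd p)"
      "\<And>q. q \<in> ball p r1 \<Longrightarrow> G q = 0 \<Longrightarrow> q \<in> Saddle F"
      by (rule saddle_neighbourhood[OF sad cc_p]; rule that; assumption)
    obtain A where A: "open A" "fst p \<in> A"
      "\<And>x. x \<in> A \<Longrightarrow> F (x, snd p) = F p \<Longrightarrow> (x, snd p) \<in> Saddle F"
      using level[of "fst p" "snd p"] sad by auto
    have "open (U \<inter> A \<times> UNIV)" "p \<in> U \<inter> A \<times> UNIV"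
      using U A p by (auto simp: mem_Times_iff intro!: open_Int open_Times)
    then obtain r2 where r2: "r2 > 0" "ball p r2 \<subseteq> U \<inter> A \<times> UNIV"
      unfolding open_contains_ball by blast
    \<comment> \<open>\<open>e\<close> serves the stability estimate, \<open>r1\<close> the decay
      near \<open>p\<close>, and \<open>r2\<close> both the isolating set \<open>U\<close> and the
      level set neighborhood \<open>A\<close>.\<close>
    define r where "r = min e (min r1 r2)"
    have in_r1: "q \<in> ball p r1" if "q \<in> ball p r" for q
      using that by (simp add: r_def)
    have in_UA: "q \<in> U \<inter> A \<times> UNIV" if "q \<in> ball p r" for q
      using r2(2) that by (force simp: r_def)
    have in_U: "q \<in> U" and in_A: "fst q \<in> A" if "q \<in> ball p r" for q
      using in_UA[OF that] by (simp_all add: mem_Times_iff)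
    have neg: "inner (q - p) (saddle_field F q) \<le> 0" if "q \<in> ball p r" for q
      using r1(2,3)[OF in_r1[OF that]] by simp
    have "(\<forall>t\<ge>0. dist p (\<gamma> t) < r) \<and> (\<exists>q\<in>Sc. (\<gamma> \<longlongrightarrow> q) at_top)"
      if tr: "trajectory (saddle_field F) \<gamma>" and start: "\<gamma> 0 \<in> ball p r" for \<gamma>
    proof (intro conjI allI impI)
      show "dist p (\<gamma> t) < r" if "t \<ge> 0" for t
        using trajectory_dist_decreasing[OF tr neg _ that start] start by simp
      have "\<exists>q \<in> Saddle F \<inter> ball p r. (\<gamma> \<longlongrightarrow> q) at_top"
        by (rule trajectory_tendsto_saddle[OF tr start convex_concave sad r1(2)[OF in_r1]
              r1(3)[OF in_r1] r1(4)[OF in_r1] A(3)[OF in_A]])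
      then show "\<exists>q\<in>Sc. (\<gamma> \<longlongrightarrow> q) at_top" using in_U U(3) by blast
    qed
    moreover have "r > 0" "r \<le> e" using e r1(1) r2(1) by (auto simp: r_def)
    ultimately show ?thesis by blast
  qed
  have tube: "\<exists>W. open W \<and> Sc \<subseteq> W \<and>
      (\<forall>\<gamma>. trajectory (saddle_field F) \<gamma> \<and> \<gamma> 0 \<in> W \<longrightarrow>
        (\<forall>t\<ge>0. infdist (\<gamma> t) Sc < e) \<and> (\<exists>q\<in>Sc. (\<gamma> \<longlongrightarrow> q) at_top))"
    if e: "e > 0" for e
  proof -
    \<comment> \<open>The radius varies with \<open>p\<close>, since \<open>Sc\<close> need not be
      compact. The union of the balls is still an open neighborhood, and \<open>R p \<le> e\<close>
      makes the distance bound uniform.\<close>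
    obtain R where R: "\<And>p. p \<in> Sc \<Longrightarrow> R p > 0" "\<And>p. p \<in> Sc \<Longrightarrow> R p \<le> e"
      "\<And>p \<gamma>. p \<in> Sc \<Longrightarrow> trajectory (saddle_field F) \<gamma> \<Longrightarrow> \<gamma> 0 \<in> ball p (R p) \<Longrightarrow>
        (\<forall>t\<ge>0. dist p (\<gamma> t) < R p) \<and> (\<exists>q\<in>Sc. (\<gamma> \<longlongrightarrow> q) at_top)"
      using local[OF _ e] by metis
    show ?thesis
    proof (intro exI[of _ "\<Union>p\<in>Sc. ball p (R p)"] conjI allI impI)
      show "Sc \<subseteq> (\<Union>p\<in>Sc. ball p (R p))" using R(1) by force
    next
      fix \<gamma> and t :: real
      assume "trajectory (saddle_field F) \<gamma> \<and> \<gamma> 0 \<in> (\<Union>p\<in>Sc. ball p (R p))" "0 \<le> t"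
      then obtain p where "p \<in> Sc" "dist p (\<gamma> t) < R p" using R(3) by blast
      then show "infdist (\<gamma> t) Sc < e"
        using infdist_le[of p Sc "\<gamma> t"] R(2)[of p] by (simp add: dist_commute)
    qed (use R(3) in auto)
  qed
  have to_Sc: "((\<lambda>t. infdist (\<gamma> t) Sc) \<longlongrightarrow> 0) at_top" if "q \<in> Sc" "(\<gamma> \<longlongrightarrow> q) at_top" for \<gamma> q
    using tendsto_infdist[OF that(2), of Sc] that(1) by simp
  obtain W where W: "open W" "Sc \<subseteq> W"
    \<comment> \<open>Only the convergence half of \<open>tube\<close> is kept here, so the choice
      \<open>e = 1\<close> is arbitrary.\<close>
    "\<And>\<gamma>. trajectory (saddle_field F) \<gamma> \<Longrightarrow> \<gamma> 0 \<in> W \<Longrightarrow> \<exists>q\<in>Sc. (\<gamma> \<longlongrightarrow> q) at_top"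
    using tube[OF zero_less_one] by blast
  show "locally_asymptotically_stable (saddle_field F) Sc \<and>
      convergence_to_a_point (saddle_field F) Sc"
    unfolding locally_asymptotically_stable_def convergence_to_a_point_def
  proof (intro conjI allI impI)
    show "Sc \<subseteq> equilibria (saddle_field F)" using sub saddle_imp_equilibrium by blast
    show "\<exists>W. open W \<and> Sc \<subseteq> W \<and> (\<forall>\<gamma>. trajectory (saddle_field F) \<gamma> \<and> \<gamma> 0 \<in> W \<longrightarrow>
        (\<forall>t\<ge>0. infdist (\<gamma> t) Sc < e))" if "e > 0" for e
      using tube[OF that] by metis
    show "\<exists>W. open W \<and> Sc \<subseteq> W \<and> (\<forall>\<gamma>. trajectory (saddle_field F) \<gamma> \<and> \<gamma> 0 \<in> W \<longrightarrow>
        ((\<lambda>t. infdist (\<gamma> t) Sc) \<longlongrightarrow> 0) at_top)"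
      using W to_Sc by metis
    show "\<exists>W. open W \<and> Sc \<subseteq> W \<and> (\<forall>\<gamma>. trajectory (saddle_field F) \<gamma> \<and> \<gamma> 0 \<in> W \<longrightarrow>
        (\<exists>p\<in>Sc. (\<gamma> \<longlongrightarrow> p) at_top))"
      using W by metis
  qed
qed

end
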